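(* Let $f\in L^2(\mathcal X,\mu)$ with $\mathbb V_\mu[f]>0$, and let $\hat f$ be an arbitrary approximation of $f$ constructed from a training sample of size $n$ by a fixed deterministic learning procedure. Suppose the design points are sampled i.i.d. from $\mu$ and that $\mathbb E\|f-\hat f\|_\mu^2<\infty$. Put $$\mathcal R^2=\frac{\mathbb E\|f-\hat f\|_\mu^2}{\mathbb V_\mu[f]},\qquad \mathcal R\ge0.$$ Let $(S_U,\hat S_U)$ denote either the Sobol' indices of $f$ and $\hat f$ for $U$, or (for all $U$ simultaneously) the total-effect indices of $f$ and $\hat f$ for $U$. Then in both cases $$\max_{U\subseteq\{1,\dots,d\}}\mathbb E\big(S_U-\hat S_U\big)^2\le\mathcal R^2,$$ and for every $U\subseteq\{1,\dots,d\}$ $$\mathbb E\big|S_U-\hat S_U\big|\le\mathcal R\,\big(\mathcal R+2\sqrt{S_U}\big).$$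
   Context: $\mathcal X=\mathcal X_1\times\dots\times\mathcal X_d$ with $\mathcal X_i\subseteq\mathbb R$, and $\mu=\mu_1\otimes\dots\otimes\mu_d$ is a product of probability measures $\mu_i$ on $\mathcal X_i$. $\|\cdot\|_\mu$ is the norm of $L^2(\mathcal X,\mu)$; $\mathbb E_\mu,\mathbb V_\mu$ are mean and variance under $\mu$. Every $f\in L^2(\mathcal X,\mu)$ has a unique Sobol-Hoeffding decomposition $f(x)=\sum_{U\subseteq\{1,\dots,d\}}f_U(x_U)$, where $f_U$ depends only on $x_U=(x_i)_{i\in U}$, $f_\emptyset=\mathbb E_\mu[f]$, and $\int_{\mathcal X_i}f_U(x_U)\,d\mu_i(x_i)=0$ for every $i\in U$. When $\mathbb V_\mu[f]>0$, the Sobol' index of $U$ is $S_U=\mathbb V_\mu[f_U]/\mathbb V_\mu[f]$, and the total-effect index of $U$ is $T_U=\sum_{V:\,V\cap U\ne\emptyset}S_V$ ($S_\emptyset=T_\emptyset=0$). Indices of $\hat f$ are denoted with hats; if $\mathbb V_\mu[\hat f]=0$, the indices of $\hat f$ are by convention all set equal to $2^{-d}$. Training sample: design points $x_1,\dots,x_n\in\mathcal X$ and observations $y_i=f(x_i)+\eta_i$, where the $\eta_i$ are i.i.d. with $\mathbb E\eta_i=0$, $\mathbb V\eta_i=\sigma^2<\infty$ ($\sigma^2=0$ allowed), independent of the design. A deterministic learning procedure is a map $(x_1,\dots,x_n;y_1,\dots,y_n)\mapsto\hat f\in L^2(\mathcal X,\mu)$, so a fixed training sample determines $\hat f$ uniquely.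 $\mathbb E$ without subscript is expectation over the random design and the noise; the learning procedure is tacitly assumed to be such that the random quantities whose expectations are taken are measurable. *)

theory Defs
  imports "HOL-Probability.Probability"
begin

text \<open>
  Elements of the square-integrable function space are handled through representatives, and points of
  the product space are extensional functions on the index set \<open>{1..d}\<close>.
\<close>

definition L2 :: "'a measure \<Rightarrow> ('a \<Rightarrow> real) set" where
  "L2 M = {f \<in> borel_measurable M. integrable M (\<lambda>x. (f x)\<^sup>2)}"

definition L2norm :: "'a measure \<Rightarrow> ('a \<Rightarrow> real) \<Rightarrow> real" where
  "L2norm M f = sqrt (\<integral>x. (f x)\<^sup>2 \<partial>M)"

text \<open>
  Each \<open>F U\<close> is a function on the whole product space that ignores the coordinates outside \<open>U\<close>.
  The equality with \<open>f\<close> and the vanishing of the partial integrals hold almost everywhere, the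
  partial integrals of a square-integrable function being defined only almost everywhere.
\<close>

definition sobol_hoeffding ::
  "nat \<Rightarrow> (nat \<Rightarrow> real measure) \<Rightarrow> ((nat \<Rightarrow> real) \<Rightarrow> real) \<Rightarrow> (nat set \<Rightarrow> (nat \<Rightarrow> real) \<Rightarrow> real) \<Rightarrow> bool"
where
  "sobol_hoeffding d \<mu> f F \<longleftrightarrow>
     (AE x in PiM {1..d} \<mu>. f x = (\<Sum>U\<in>Pow {1..d}. F U x)) \<and>
     (\<forall>U\<subseteq>{1..d}.
        F U \<in> L2 (PiM {1..d} \<mu>) \<and>
        (\<forall>x\<in>space (PiM {1..d} \<mu>). \<forall>y\<in>space (PiM {1..d} \<mu>).
           (\<forall>i\<in>U. x i = y i) \<longrightarrow> F U x = F U y) \<and>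
        (\<forall>i\<in>U. AE x in PiM {1..d} \<mu>. (\<integral>t. F U (x(i := t)) \<partial>\<mu> i) = 0)) \<and>
     (\<forall>x\<in>space (PiM {1..d} \<mu>). F {} x = prob_space.expectation (PiM {1..d} \<mu>) f)"

text \<open>
  The decomposition of a square-integrable function exists and is unique up to null sets, so
  the variances of the chosen components do not depend on the choice.
\<close>

definition sobol_component ::
  "nat \<Rightarrow> (nat \<Rightarrow> real measure) \<Rightarrow> ((nat \<Rightarrow> real) \<Rightarrow> real) \<Rightarrow> nat set \<Rightarrow> (nat \<Rightarrow> real) \<Rightarrow> real"
where
  "sobol_component d \<mu> f = (SOME F. sobol_hoeffding d \<mu> f F)"

text \<open>By convention, all indices of a function of variance zero are \<open>1 / 2 ^ d\<close>, also for \<open>U = {}\<close>.\<close>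

definition sobol_index ::
  "nat \<Rightarrow> (nat \<Rightarrow> real measure) \<Rightarrow> ((nat \<Rightarrow> real) \<Rightarrow> real) \<Rightarrow> nat set \<Rightarrow> real"
where
  "sobol_index d \<mu> f U =
     (if prob_space.variance (PiM {1..d} \<mu>) f = 0 then 1 / 2 ^ d
      else prob_space.variance (PiM {1..d} \<mu>) (sobol_component d \<mu> f U)
             / prob_space.variance (PiM {1..d} \<mu>) f)"

definition total_effect_index ::
  "nat \<Rightarrow> (nat \<Rightarrow> real measure) \<Rightarrow> ((nat \<Rightarrow> real) \<Rightarrow> real) \<Rightarrow> nat set \<Rightarrow> real"
where
  "total_effect_index d \<mu> f U =
     (if prob_space.variance (PiM {1..d} \<mu>) f = 0 then 1 / 2 ^ d
      else (\<Sum>V | V \<subseteq> {1..d} \<and> V \<inter> U \<noteq> {}. sobol_index d \<mu> f V))"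

end

theory Submission imports Defs begin

text \<open>
  The bounds already hold for every fixed approximation \<open>g\<close> of \<open>f\<close>, with the relative error
  \<open>r = \<parallel>f - g\<parallel> / sqrt (Var f)\<close> in place of \<open>R\<close> (lemma \<open>index_difference\<close>). The theorem follows by
  taking expectations over the sample, since \<open>E r\<^sup>2 = R\<^sup>2\<close> and therefore \<open>E r \<le> R\<close>.

  For fixed \<open>g\<close>, the components of \<open>f\<close> and \<open>g\<close> for distinct index sets are orthogonal, so that
  \<open>\<parallel>f - g\<parallel>\<^sup>2\<close> is the sum of the squared distances \<open>\<parallel>f\<^sub>U - g\<^sub>U\<parallel>\<^sup>2\<close>, and \<open>Var f\<close> is the sum of the
  \<open>Var f\<^sub>U\<close>. By the Cauchy-Schwarz inequality, \<open>\<parallel>f - g\<parallel>\<close> is at least the Euclidean distance of the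
  vectors of standard deviations of the components (lemma \<open>dist_ge_component_dist\<close>). A Sobol' index
  and a total-effect index are both the share of the variance carried by a family \<open>K\<close> of index sets.
  Grouping the components into \<open>K\<close> and its complement leaves two vectors in the nonnegative quadrant
  of the plane, where the bounds are elementary (lemma \<open>share_difference_plane\<close>): if \<open>\<alpha>\<close> and \<open>\<beta>\<close> are
  the angles of the vectors, the shares are \<open>(cos \<alpha>)\<^sup>2\<close> and \<open>(cos \<beta>)\<^sup>2\<close>, they differ by
  \<open>sin (\<beta> + \<alpha>) * sin (\<beta> - \<alpha>)\<close>, and \<open>\<bar>sin (\<beta> - \<alpha>)\<bar> \<le> r\<close>. If \<open>g\<close> has variance zero, then \<open>r \<ge> 1\<close>
  and the bounds hold because all indices lie in the unit interval.

  The components are chosen by an indefinite description, so the existence of the decomposition has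
  to be proved. The component for \<open>U\<close> is the alternating sum of the conditional means given the
  coordinates in the subsets of \<open>U\<close>. Its partial integrals vanish because averaging a conditional
  mean over coordinate \<open>i\<close> removes \<open>i\<close> from the conditioning set, which makes the terms cancel in
  pairs, and the components add up to \<open>f\<close> by Moebius inversion.
\<close>

section \<open>Square-integrable functions\<close>

lemma L2_mult_integrable:
  assumes "f \<in> L2 N" "g \<in> L2 N"
  shows "integrable N (\<lambda>x. f x * g x)"
proof (rule Bochner_Integration.integrable_bound)
  show "integrable N (\<lambda>x. (f x)\<^sup>2 + (g x)\<^sup>2)"
    using assms by (auto simp: L2_def)
  show "(\<lambda>x. f x * g x) \<in> borel_measurable N"
    using assms by (auto simp: L2_def)
  have "\<bar>a * b\<bar> \<le> a\<^sup>2 + b\<^sup>2" for a b :: real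
  proof -
    have "2 * (\<bar>a\<bar> * \<bar>b\<bar>) \<le> a\<^sup>2 + b\<^sup>2"
      using zero_le_power2[of "\<bar>a\<bar> - \<bar>b\<bar>"] by (simp add: power2_diff)
    moreover have "0 \<le> \<bar>a\<bar> * \<bar>b\<bar>" by simp
    ultimately show ?thesis unfolding abs_mult by linarith
  qed
  then show "AE x in N. norm (f x * g x) \<le> norm ((f x)\<^sup>2 + (g x)\<^sup>2)"
    by (auto simp: abs_of_nonneg)
qed

lemma L2_add:
  assumes "f \<in> L2 N" "g \<in> L2 N"
  shows "(\<lambda>x. f x + g x) \<in> L2 N"
  using assms L2_mult_integrable[OF assms] by (simp add: L2_def power2_sum mult.assoc borel_measurable_add)

lemma L2_cmult:
  assumes "f \<in> L2 N"
  shows "(\<lambda>x. c * f x) \<in> L2 N"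
  using assms by (simp add: L2_def power_mult_distrib borel_measurable_times)

lemma L2_sum:
  assumes "\<And>i. i \<in> A \<Longrightarrow> f i \<in> L2 N"
  shows "(\<lambda>x. \<Sum>i\<in>A. f i x) \<in> L2 N"
proof (cases "finite A")
  case True
  then show ?thesis using assms
    by (induction A rule: finite_induct) (auto simp: L2_add, auto simp: L2_def)
qed (simp add: L2_def)

lemma L2_Cauchy_Schwarz:
  assumes "f \<in> L2 N" "g \<in> L2 N"
  shows "(\<integral>x. f x * g x \<partial>N) \<le> sqrt (\<integral>x. (f x)\<^sup>2 \<partial>N) * sqrt (\<integral>x. (g x)\<^sup>2 \<partial>N)"
proof -
  define A where "A = (\<integral>x. (f x)\<^sup>2 \<partial>N)"
  define B where "B = (\<integral>x. (g x)\<^sup>2 \<partial>N)"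
  define C where "C = (\<integral>x. f x * g x \<partial>N)"
  note ints [simp] = L2_mult_integrable[OF assms]
    L2_mult_integrable[OF assms(1) assms(1)] L2_mult_integrable[OF assms(2) assms(2)]
  \<comment> \<open>The inequality is the nonpositivity of the discriminant of this quadratic form.\<close>
  have quad: "0 \<le> s\<^sup>2 * A + 2 * s * t * C + t\<^sup>2 * B" for s t
  proof -
    have "0 \<le> (\<integral>x. (s * f x + t * g x)\<^sup>2 \<partial>N)" by simp
    also have "\<dots> = (\<integral>x. s\<^sup>2 * (f x * f x) + 2 * s * t * (f x * g x) + t\<^sup>2 * (g x * g x) \<partial>N)"
      by (simp add: power2_eq_square algebra_simps)
    also have "\<dots> = s\<^sup>2 * A + 2 * s * t * C + t\<^sup>2 * B"
      by (simp add: A_def B_def C_def power2_eq_square)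
    finally show ?thesis .
  qed
  have AB: "0 \<le> A" "0 \<le> B" by (simp_all add: A_def B_def)
  have "C\<^sup>2 \<le> A * B"
  proof (cases "A = 0 \<and> B = 0")
    case True
    then show ?thesis using quad[of 1 1] quad[of 1 "-1"] by simp
  next
    case False
    have "0 \<le> B * (A * B - C\<^sup>2)" "0 \<le> A * (A * B - C\<^sup>2)"
      using quad[of B "-C"] quad[of C "-A"] by (simp_all add: power2_eq_square algebra_simps)
    with False AB show ?thesis by (auto simp: zero_le_mult_iff)
  qed
  then have "C \<le> sqrt (A * B)" using real_le_rsqrt by blast
  then show ?thesis by (simp add: real_sqrt_mult A_def B_def C_def)
qed

section \<open>Resampling coordinates under a product of probability measures\<close>

locale finite_prob_family =
  fixes I :: "'i set" and \<mu> :: "'i \<Rightarrow> 'a measure"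
  assumes finite_index: "finite I"
    and prob_component: "\<And>i. i \<in> I \<Longrightarrow> prob_space (\<mu> i)"
begin

abbreviation P :: "('i \<Rightarrow> 'a) measure" where "P \<equiv> PiM I \<mu>"

lemma prob_space_P: "prob_space P"
  using prob_component by (rule prob_space_PiM)

lemma pair_prob_P: "pair_prob_space P P"
  using prob_space_P
  by (simp add: pair_prob_space_def pair_sigma_finite_def prob_space_imp_sigma_finite)

lemma pair_prob_component:
  assumes "i \<in> I"
  shows "pair_prob_space P (\<mu> i)"
  using prob_space_P prob_component[OF assms]
  by (simp add: pair_prob_space_def pair_sigma_finite_def prob_space_imp_sigma_finite)

lemma emeasure_box:
  assumes "\<And>i. i \<in> I \<Longrightarrow> A i \<in> sets (\<mu> i)"
  shows "emeasure P (Pi\<^sub>E I A) = (\<Prod>i\<in>I. emeasure (\<mu> i) (A i))"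
  using emeasure_PiM_emb[of I \<mu> I A] assms prob_component finite_index
  by (simp add: prod_emb_PiE_same_index sets.sets_into_space)

lemma measure_eqI_box:
  assumes "sets Q = sets P"
    and "\<And>A. (\<And>i. i \<in> I \<Longrightarrow> A i \<in> sets (\<mu> i)) \<Longrightarrow>
      emeasure Q (Pi\<^sub>E I A) = (\<Prod>i\<in>I. emeasure (\<mu> i) (A i))"
  shows "Q = P"
\<comment> \<open>The whole space is itself a box of finite measure, so the constant sequence exhausts it.\<close>
proof (rule measure_eqI_PiM_finite[where A = "\<lambda>_. Pi\<^sub>E I (\<lambda>i. space (\<mu> i))", symmetric])
  interpret prob_space P by (rule prob_space_P)
  show "emeasure P (Pi\<^sub>E I (\<lambda>i. space (\<mu> i))) \<noteq> \<infinity>" by simp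
  show "emeasure P (Pi\<^sub>E I A) = emeasure Q (Pi\<^sub>E I A)" if "\<And>i. i \<in> I \<Longrightarrow> A i \<in> sets (\<mu> i)" for A
    using assms(2)[of A] emeasure_box[of A] that by simp
qed (use assms finite_index in \<open>auto simp: space_PiM intro!: prod_algebraI_finite\<close>)

lemma measurable_update:
  assumes "i \<in> I"
  shows "(\<lambda>(x, t). x(i := t)) \<in> P \<Otimes>\<^sub>M \<mu> i \<rightarrow>\<^sub>M P"
proof -
  have "(\<lambda>z. (fst z)(i := snd z)) \<in> P \<Otimes>\<^sub>M \<mu> i \<rightarrow>\<^sub>M P"
    by (rule measurable_fun_upd[where J = I]) (use assms in auto)
  then show ?thesis by (simp add: case_prod_beta')
qed

lemma distr_update:
  assumes i: "i \<in> I"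
  shows "distr (P \<Otimes>\<^sub>M \<mu> i) P (\<lambda>(x, t). x(i := t)) = P"
proof (rule measure_eqI_box)
  interpret Q: pair_prob_space P "\<mu> i" using i by (rule pair_prob_component)
  fix A assume A: "\<And>j. j \<in> I \<Longrightarrow> A j \<in> sets (\<mu> j)"
  let ?B = "A(i := space (\<mu> i))"
  have B: "?B j \<in> sets (\<mu> j)" if "j \<in> I" for j using A that by auto
  have "(\<lambda>(x, t). x(i := t)) -` Pi\<^sub>E I A \<inter> space (P \<Otimes>\<^sub>M \<mu> i) = Pi\<^sub>E I ?B \<times> A i"
  proof (intro set_eqI)
    fix z :: "('i \<Rightarrow> 'a) \<times> 'a"
    obtain x t where z: "z = (x, t)" by force
    have ext: "x(i := t) \<in> extensional I \<longleftrightarrow> x \<in> extensional I"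
      using i by (auto simp: extensional_def)
    have sub: "s \<in> space (\<mu> j)" if "j \<in> I" "s \<in> A j" for j s
      using sets.sets_into_space[OF A[OF that(1)]] that(2) by blast
    show "z \<in> (\<lambda>(x, t). x(i := t)) -` Pi\<^sub>E I A \<inter> space (P \<Otimes>\<^sub>M \<mu> i) \<longleftrightarrow> z \<in> Pi\<^sub>E I ?B \<times> A i"
      using i sub by (simp add: z space_pair_measure space_PiM PiE_iff ext) blast
  qed
  then have "emeasure (distr (P \<Otimes>\<^sub>M \<mu> i) P (\<lambda>(x, t). x(i := t))) (Pi\<^sub>E I A)
      = emeasure (P \<Otimes>\<^sub>M \<mu> i) (Pi\<^sub>E I ?B \<times> A i)"
    using A finite_index measurable_update[OF i] by (simp add: emeasure_distr sets_PiM_I_finite)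
  also have "\<dots> = (\<Prod>j\<in>I. emeasure (\<mu> j) (?B j)) * emeasure (\<mu> i) (A i)"
    using A B i finite_index
    by (subst Q.M2.emeasure_pair_measure_Times) (auto intro!: sets_PiM_I_finite simp: emeasure_box)
  also have "\<dots> = (\<Prod>j\<in>I. emeasure (\<mu> j) (A j))"
  proof -
    have "(\<Prod>j\<in>I - {i}. emeasure (\<mu> j) (?B j)) = (\<Prod>j\<in>I - {i}. emeasure (\<mu> j) (A j))"
      by (intro prod.cong) auto
    then show ?thesis
      using i finite_index prob_space.emeasure_space_1[OF prob_component[OF i]]
      by (simp only: prod.remove[of I i] fun_upd_same mult_1_left mult.commute)
  qed
  finally show "emeasure (distr (P \<Otimes>\<^sub>M \<mu> i) P (\<lambda>(x, t). x(i := t))) (Pi\<^sub>E I A)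
      = (\<Prod>j\<in>I. emeasure (\<mu> j) (A j))" .
qed simp

text \<open>The point that takes the coordinates in \<open>W\<close> from \<open>x\<close> and the remaining ones from \<open>y\<close>.\<close>

definition mix :: "'i set \<Rightarrow> ('i \<Rightarrow> 'a) \<Rightarrow> ('i \<Rightarrow> 'a) \<Rightarrow> 'i \<Rightarrow> 'a" where
  "mix W x y = (\<lambda>j\<in>I. if j \<in> W then x j else y j)"

lemma measurable_mix: "(\<lambda>(x, y). mix W x y) \<in> P \<Otimes>\<^sub>M P \<rightarrow>\<^sub>M P"
  unfolding mix_def case_prod_beta'
proof (rule measurable_restrict)
  fix i assume "i \<in> I"
  then show "(\<lambda>z. if i \<in> W then fst z i else snd z i) \<in> P \<Otimes>\<^sub>M P \<rightarrow>\<^sub>M \<mu> i"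
    by (cases "i \<in> W") auto
qed

lemma distr_mix: "distr (P \<Otimes>\<^sub>M P) P (\<lambda>(x, y). mix W x y) = P"
proof (rule measure_eqI_box)
  interpret Q: pair_prob_space P P by (rule pair_prob_P)
  fix A assume A: "\<And>j. j \<in> I \<Longrightarrow> A j \<in> sets (\<mu> j)"
  let ?B = "\<lambda>j. if j \<in> W then A j else space (\<mu> j)"
  let ?C = "\<lambda>j. if j \<in> W then space (\<mu> j) else A j"
  have "(\<lambda>(x, y). mix W x y) -` Pi\<^sub>E I A \<inter> space (P \<Otimes>\<^sub>M P) = Pi\<^sub>E I ?B \<times> Pi\<^sub>E I ?C"
  proof (intro set_eqI)
    fix z :: "('i \<Rightarrow> 'a) \<times> ('i \<Rightarrow> 'a)"
    obtain x y where z: "z = (x, y)" by force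
    have sub: "s \<in> space (\<mu> j)" if "j \<in> I" "s \<in> A j" for j s
      using sets.sets_into_space[OF A[OF that(1)]] that(2) by blast
    show "z \<in> (\<lambda>(x, y). mix W x y) -` Pi\<^sub>E I A \<inter> space (P \<Otimes>\<^sub>M P)
        \<longleftrightarrow> z \<in> Pi\<^sub>E I ?B \<times> Pi\<^sub>E I ?C"
      using sub by (simp add: z space_pair_measure space_PiM PiE_iff mix_def) blast
  qed
  then have "emeasure (distr (P \<Otimes>\<^sub>M P) P (\<lambda>(x, y). mix W x y)) (Pi\<^sub>E I A)
      = emeasure (P \<Otimes>\<^sub>M P) (Pi\<^sub>E I ?B \<times> Pi\<^sub>E I ?C)"
    using A finite_index measurable_mix by (simp add: emeasure_distr sets_PiM_I_finite)
  also have "\<dots> = (\<Prod>j\<in>I. emeasure (\<mu> j) (?B j)) * (\<Prod>j\<in>I. emeasure (\<mu> j) (?C j))"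
    using A finite_index
    by (subst Q.M1.emeasure_pair_measure_Times) (auto intro!: sets_PiM_I_finite simp: emeasure_box)
  also have "\<dots> = (\<Prod>j\<in>I. emeasure (\<mu> j) (A j))"
    unfolding prod.distrib[symmetric]
    using prob_space.emeasure_space_1[OF prob_component] by (intro prod.cong) auto
  finally show "emeasure (distr (P \<Otimes>\<^sub>M P) P (\<lambda>(x, y). mix W x y)) (Pi\<^sub>E I A)
      = (\<Prod>j\<in>I. emeasure (\<mu> j) (A j))" .
qed simp

lemma update_in_space: "x \<in> space P \<Longrightarrow> i \<in> I \<Longrightarrow> t \<in> space (\<mu> i) \<Longrightarrow> x(i := t) \<in> space P"
  by (auto simp: space_PiM PiE_iff extensional_def)

lemma integrable_update:
  fixes h :: "('i \<Rightarrow> 'a) \<Rightarrow> real"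
  assumes "integrable P h" "i \<in> I"
  shows "integrable (P \<Otimes>\<^sub>M \<mu> i) (\<lambda>(x, t). h (x(i := t)))"
  using integrable_distr[OF measurable_update[OF assms(2)], of h] assms(1) distr_update[OF assms(2)]
  by (simp add: case_prod_beta')

lemma integral_update:
  fixes h :: "('i \<Rightarrow> 'a) \<Rightarrow> real"
  assumes "h \<in> borel_measurable P" "i \<in> I"
  shows "(\<integral>(x, t). h (x(i := t)) \<partial>(P \<Otimes>\<^sub>M \<mu> i)) = (\<integral>x. h x \<partial>P)"
  using integral_distr[OF measurable_update[OF assms(2)], of h] assms(1) distr_update[OF assms(2)]
  by (simp add: case_prod_beta')

lemma integrable_mix:
  fixes h :: "('i \<Rightarrow> 'a) \<Rightarrow> real"
  assumes "integrable P h"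
  shows "integrable (P \<Otimes>\<^sub>M P) (\<lambda>(x, y). h (mix W x y))"
  using integrable_distr[OF measurable_mix[of W], of h] assms distr_mix[of W]
  by (simp add: case_prod_beta')

lemma L2_integrable: "h \<in> L2 P \<Longrightarrow> integrable P h"
  using finite_measure.square_integrable_imp_integrable[of P h] prob_space_P
  by (simp add: L2_def prob_space_def)

lemma L2_const: "(\<lambda>x. c) \<in> L2 P"
  using prob_space_P by (simp add: L2_def prob_space_def finite_measure.integrable_const)

text \<open>
  A function with vanishing partial integral along coordinate \<open>i\<close> is orthogonal to every function
  that does not depend on coordinate \<open>i\<close>.
\<close>

lemma orthogonal_of_partial_integral_zero:
  assumes F: "F \<in> L2 P" and G: "G \<in> L2 P" and i: "i \<in> I"
    and zero: "AE x in P. (\<integral>t. F (x(i := t)) \<partial>\<mu> i) = 0"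
    and indep: "\<And>x t. x \<in> space P \<Longrightarrow> t \<in> space (\<mu> i) \<Longrightarrow> G (x(i := t)) = G x"
  shows "(\<integral>x. F x * G x \<partial>P) = 0"
proof -
  interpret Q: pair_prob_space P "\<mu> i" using i by (rule pair_prob_component)
  let ?h = "\<lambda>x. F x * G x"
  have h: "integrable P ?h" using F G by (rule L2_mult_integrable)
  have "(\<integral>x. ?h x \<partial>P) = (\<integral>(x, t). ?h (x(i := t)) \<partial>(P \<Otimes>\<^sub>M \<mu> i))"
    using integral_update[OF borel_measurable_integrable[OF h] i] by simp
  also have "\<dots> = (\<integral>x. (\<integral>t. ?h (x(i := t)) \<partial>\<mu> i) \<partial>P)"
    using Q.integral_fst[OF integrable_update[OF h i]] by simp
  also have "\<dots> = (\<integral>x. 0 \<partial>P)"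
  proof (rule integral_cong_AE)
    show "(\<lambda>x. \<integral>t. ?h (x(i := t)) \<partial>\<mu> i) \<in> borel_measurable P"
      using Q.integrable_fst[OF integrable_update[OF h i]] by (rule borel_measurable_integrable)
    show "AE x in P. (\<integral>t. ?h (x(i := t)) \<partial>\<mu> i) = 0"
      using zero AE_space
    proof eventually_elim
      case (elim x)
      have "(\<integral>t. ?h (x(i := t)) \<partial>\<mu> i) = (\<integral>t. F (x(i := t)) * G x \<partial>\<mu> i)"
        using elim(2) by (intro Bochner_Integration.integral_cong) (simp_all add: indep)
      then show ?case using elim(1) by simp
    qed
  qed simp
  finally show ?thesis by simp
qed

section \<open>Existence of the Sobol-Hoeffding decomposition\<close>

text \<open>
  A version of the conditional mean of \<open>f\<close> given the coordinates in \<open>W\<close>. Integrating over all coordinates of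
  \<open>y\<close> instead of those outside \<open>W\<close> changes nothing, the measure being a product of
  probability measures.
\<close>

definition cond_mean :: "(('i \<Rightarrow> 'a) \<Rightarrow> real) \<Rightarrow> 'i set \<Rightarrow> ('i \<Rightarrow> 'a) \<Rightarrow> real" where
  "cond_mean f W x = (\<integral>y. f (mix W x y) \<partial>P)"

lemma cond_mean_cong:
  assumes "\<And>i. i \<in> W \<Longrightarrow> i \<in> I \<Longrightarrow> x i = y i"
  shows "cond_mean f W x = cond_mean f W y"
proof -
  have "mix W x = mix W y" using assms by (auto simp: mix_def fun_eq_iff)
  then show ?thesis by (simp add: cond_mean_def)
qed

lemma cond_mean_empty: "cond_mean f {} x = (\<integral>y. f y \<partial>P)"
  unfolding cond_mean_def mix_def
  by (intro Bochner_Integration.integral_cong) (auto simp: space_PiM extensional_restrict PiE_iff)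

lemma cond_mean_full:
  assumes "x \<in> space P"
  shows "cond_mean f I x = f x"
proof -
  interpret prob_space P by (rule prob_space_P)
  have "mix I x y = x" for y
    using assms by (auto simp: mix_def space_PiM PiE_iff extensional_def)
  then show ?thesis by (simp add: cond_mean_def prob_space)
qed

lemma cond_mean_L2:
  assumes f: "f \<in> L2 P"
  shows "cond_mean f W \<in> L2 P"
proof -
  interpret Q: pair_prob_space P P by (rule pair_prob_P)
  have f1: "integrable P f" and f2: "integrable P (\<lambda>x. (f x)\<^sup>2)"
    using f L2_integrable[OF f] by (simp_all add: L2_def)
  note i1 = integrable_mix[OF f1, of W] and i2 = integrable_mix[OF f2, of W]
  have meas: "cond_mean f W \<in> borel_measurable P"
    using borel_measurable_integrable[OF Q.integrable_fst[OF i1]]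
    by (simp add: cond_mean_def[abs_def])
  have "integrable P (\<lambda>x. (cond_mean f W x)\<^sup>2)"
  proof (rule Bochner_Integration.integrable_bound)
    show "integrable P (\<lambda>x. \<integral>y. (f (mix W x y))\<^sup>2 \<partial>P)"
      using Q.integrable_fst[OF i2] .
    show "(\<lambda>x. (cond_mean f W x)\<^sup>2) \<in> borel_measurable P" using meas by simp
    show "AE x in P. norm ((cond_mean f W x)\<^sup>2) \<le> norm (\<integral>y. (f (mix W x y))\<^sup>2 \<partial>P)"
      using Q.AE_integrable_fst[OF i1] Q.AE_integrable_fst[OF i2]
    proof eventually_elim
      case (elim x)
      \<comment> \<open>Jensen's inequality for the square, as nonnegativity of the variance in \<open>y\<close>.\<close>
      show ?case
        using Q.M1.variance_eq[OF elim] Q.M1.variance_positive[of "\<lambda>y. f (mix W x y)"]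
        by (simp add: cond_mean_def)
    qed
  qed
  with meas show ?thesis by (simp add: L2_def)
qed

text \<open>
  Averaging a conditional mean over one coordinate removes that coordinate from the conditioning
  set. This holds only almost everywhere, since it exchanges two integrals of a section of \<open>f\<close> and
  sections are integrable only almost everywhere.
\<close>

lemma partial_integral_cond_mean:
  assumes f: "f \<in> L2 P" and i: "i \<in> I"
  shows "AE x in P. (\<integral>t. cond_mean f W (x(i := t)) \<partial>\<mu> i) = cond_mean f (W - {i}) x"
proof (cases "i \<in> W")
  case False
  have "cond_mean f W (x(i := t)) = cond_mean f (W - {i}) x" for x t
  proof -
    have "cond_mean f W (x(i := t)) = cond_mean f W x"
      by (rule cond_mean_cong) (use False in auto)
    then show ?thesis using False by simp
  qed
  then show ?thesis
    using prob_space.prob_space[OF prob_component[OF i]] by simp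
next
  case True
  interpret Q: pair_prob_space P "\<mu> i" using i by (rule pair_prob_component)
  interpret R: pair_prob_space P P by (rule pair_prob_P)
  have "AE x in P. integrable P (\<lambda>y. f (mix (W - {i}) x y))"
    using R.AE_integrable_fst[OF integrable_mix[OF L2_integrable[OF f]]] .
  then show ?thesis
  proof eventually_elim
    case (elim x)
    let ?h = "\<lambda>y. f (mix (W - {i}) x y)"
    \<comment> \<open>Updating \<open>x\<close> at a coordinate taken from \<open>x\<close> is the same as taking it from an updated \<open>y\<close>.\<close>
    have mix_eq: "mix W (x(i := t)) y = mix (W - {i}) x (y(i := t))" for t y
      using True by (auto simp: mix_def)
    have "(\<integral>t. cond_mean f W (x(i := t)) \<partial>\<mu> i) = (\<integral>t. (\<integral>y. ?h (y(i := t)) \<partial>P) \<partial>\<mu> i)"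
      by (simp add: cond_mean_def mix_eq)
    also have "\<dots> = (\<integral>(y, t). ?h (y(i := t)) \<partial>(P \<Otimes>\<^sub>M \<mu> i))"
      using Q.integral_snd[OF integrable_update[OF elim i]] by simp
    also have "\<dots> = (\<integral>y. ?h y \<partial>P)"
      using integral_update[OF borel_measurable_integrable[OF elim] i] by simp
    finally show ?case by (simp add: cond_mean_def)
  qed
qed

text \<open>The component of \<open>f\<close> for \<open>U\<close>, obtained by Moebius inversion of the conditional means.\<close>

definition component :: "(('i \<Rightarrow> 'a) \<Rightarrow> real) \<Rightarrow> 'i set \<Rightarrow> ('i \<Rightarrow> 'a) \<Rightarrow> real" where
  "component f U x = (-1) ^ card U * (\<Sum>W\<in>Pow U. (-1) ^ card W * cond_mean f W x)"

lemma component_L2: "f \<in> L2 P \<Longrightarrow> component f U \<in> L2 P"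
  unfolding component_def[abs_def] by (intro L2_cmult L2_sum cond_mean_L2)

lemma component_cong:
  assumes "\<And>i. i \<in> U \<Longrightarrow> x i = y i"
  shows "component f U x = component f U y"
proof -
  have "cond_mean f W x = cond_mean f W y" if "W \<in> Pow U" for W
    using that assms by (intro cond_mean_cong) auto
  then show ?thesis by (simp add: component_def)
qed

lemma component_empty: "component f {} x = (\<integral>y. f y \<partial>P)"
  by (simp add: component_def cond_mean_empty)

lemma sum_component:
  assumes "x \<in> space P"
  shows "(\<Sum>U\<in>Pow I. component f U x) = f x"
proof -
  have "cond_mean f I x = (\<Sum>T\<in>Pow I. (-1) ^ card T * ((-1) ^ card T * component f T x))"
  proof (rule inclusion_exclusion_symmetric[where f = "\<lambda>T. cond_mean f T x"
        and g = "\<lambda>T. (-1) ^ card T * component f T x", OF _ finite_index])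
    show "\<And>S :: 'i set. finite S \<Longrightarrow> (-1) ^ card S * component f S x = (\<Sum>T\<in>Pow S. (-1) ^ card T * cond_mean f T x)"
      by (simp add: component_def mult.assoc[symmetric] power_add[symmetric])
  qed
  then show ?thesis
    using assms by (simp add: cond_mean_full mult.assoc[symmetric] power_add[symmetric])
qed

text \<open>The sets containing \<open>i\<close> cancel against those not containing it.\<close>

lemma alternating_sum_Pow_remove:
  fixes c :: "'b set \<Rightarrow> real"
  assumes "finite U" "i \<in> U"
  shows "(\<Sum>W\<in>Pow U. (-1) ^ card W * c (W - {i})) = 0"
proof -
  let ?V = "U - {i}"
  have U: "Pow U = Pow ?V \<union> insert i ` Pow ?V"
    using assms(2) Pow_insert[of i ?V] by (simp add: insert_absorb)
  have inj: "inj_on (insert i) (Pow ?V)" by (auto simp: inj_on_def)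
  have "(\<Sum>W\<in>Pow U. (-1) ^ card W * c (W - {i}))
    = (\<Sum>W\<in>Pow ?V. (-1) ^ card W * c (W - {i})) + (\<Sum>W\<in>insert i ` Pow ?V. (-1) ^ card W * c (W - {i}))"
    unfolding U using assms(1) by (intro sum.union_disjoint) auto
  also have "(\<Sum>W\<in>insert i ` Pow ?V. (-1) ^ card W * c (W - {i}))
    = (\<Sum>W\<in>Pow ?V. - ((-1) ^ card W * c (W - {i})))"
    unfolding sum.reindex[OF inj] o_def
  proof (rule sum.cong)
    fix W assume W: "W \<in> Pow ?V"
    then have "finite W" "i \<notin> W" using assms(1) finite_subset by auto
    then show "(-1) ^ card (insert i W) * c (insert i W - {i}) = - ((-1) ^ card W * c (W - {i}))"
      by simp
  qed simp
  finally show ?thesis by (simp add: sum_negf)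
qed

lemma partial_integral_component:
  assumes f: "f \<in> L2 P" and U: "U \<subseteq> I" "i \<in> U"
  shows "AE x in P. (\<integral>t. component f U (x(i := t)) \<partial>\<mu> i) = 0"
proof -
  have i: "i \<in> I" and finU: "finite U" using U finite_index finite_subset by auto
  interpret Q: pair_prob_space P "\<mu> i" using i by (rule pair_prob_component)
  have "AE x in P. \<forall>W\<in>Pow U. integrable (\<mu> i) (\<lambda>t. cond_mean f W (x(i := t)))"
    using finU i f
    by (intro AE_finite_allI)
      (auto intro!: Q.AE_integrable_fst integrable_update L2_integrable cond_mean_L2)
  moreover have "AE x in P. \<forall>W\<in>Pow U.
      (\<integral>t. cond_mean f W (x(i := t)) \<partial>\<mu> i) = cond_mean f (W - {i}) x"
    using finU i f by (intro AE_finite_allI) (auto intro!: partial_integral_cond_mean)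
  ultimately show ?thesis
  proof eventually_elim
    case (elim x)
    have "(\<integral>t. component f U (x(i := t)) \<partial>\<mu> i)
      = (-1) ^ card U * (\<Sum>W\<in>Pow U. (-1) ^ card W * (\<integral>t. cond_mean f W (x(i := t)) \<partial>\<mu> i))"
      unfolding component_def using elim(1)
      by (subst integral_mult_right_zero, subst Bochner_Integration.integral_sum) auto
    also have "\<dots> = (-1) ^ card U * (\<Sum>W\<in>Pow U. (-1) ^ card W * cond_mean f (W - {i}) x)"
      using elim(2) by simp
    also have "\<dots> = 0" using alternating_sum_Pow_remove[OF finU U(2)] by simp
    finally show ?case .
  qed
qed

end

section \<open>Orthogonality of the components\<close>

locale sobol_space = finite_prob_family "{1..d}" \<mu>
  for d :: nat and \<mu> :: "nat \<Rightarrow> real measure"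
begin

\<comment> \<open>Keeps the index set \<open>{1..d}\<close> from being rewritten to \<open>{Suc 0..d}\<close>.\<close>
declare One_nat_def [simp del]

lemma sobol_hoeffding_component:
  assumes f: "f \<in> L2 P"
  shows "sobol_hoeffding d \<mu> f (component f)"
  unfolding sobol_hoeffding_def
proof (intro conjI allI ballI impI)
  show "AE x in P. f x = (\<Sum>U\<in>Pow {1..d}. component f U x)"
    by (rule AE_I2) (simp add: sum_component)
  show "AE x in P. (\<integral>t. component f U (x(i := t)) \<partial>\<mu> i) = 0"
    if "U \<subseteq> {1..d}" "i \<in> U" for U i
    using f that by (rule partial_integral_component)
qed (use f in \<open>auto simp: component_L2 component_empty intro: component_cong\<close>)

lemma sobol_hoeffding_sobol_component:
  assumes "f \<in> L2 P"
  shows "sobol_hoeffding d \<mu> f (sobol_component d \<mu> f)"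
  unfolding sobol_component_def using sobol_hoeffding_component[OF assms] by (rule someI[of "sobol_hoeffding d \<mu> f"])

lemma sobol_hoeffding_L2: "sobol_hoeffding d \<mu> f F \<Longrightarrow> U \<subseteq> {1..d} \<Longrightarrow> F U \<in> L2 P"
  unfolding sobol_hoeffding_def by blast

lemma sobol_hoeffding_sum:
  "sobol_hoeffding d \<mu> f F \<Longrightarrow> AE x in P. f x = (\<Sum>U\<in>Pow {1..d}. F U x)"
  unfolding sobol_hoeffding_def by blast

lemma sobol_hoeffding_partial_integral:
  "sobol_hoeffding d \<mu> f F \<Longrightarrow> U \<subseteq> {1..d} \<Longrightarrow> i \<in> U \<Longrightarrow>
    AE x in P. (\<integral>t. F U (x(i := t)) \<partial>\<mu> i) = 0"
  unfolding sobol_hoeffding_def by blast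

lemma sobol_hoeffding_empty:
  "sobol_hoeffding d \<mu> f F \<Longrightarrow> x \<in> space P \<Longrightarrow> F {} x = (\<integral>y. f y \<partial>P)"
  unfolding sobol_hoeffding_def by blast

lemma sobol_hoeffding_orthogonal:
  assumes F: "sobol_hoeffding d \<mu> f F" and U: "U \<subseteq> {1..d}" "i \<in> U"
    and G: "sobol_hoeffding d \<mu> g G" and V: "V \<subseteq> {1..d}" "i \<notin> V"
  shows "(\<integral>x. F U x * G V x \<partial>P) = 0"
proof (rule orthogonal_of_partial_integral_zero)
  show i: "i \<in> {1..d}" using U by blast
  show "F U \<in> L2 P" "G V \<in> L2 P" using F G U V by (simp_all add: sobol_hoeffding_L2)
  show "AE x in P. (\<integral>t. F U (x(i := t)) \<partial>\<mu> i) = 0"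
    using F U by (rule sobol_hoeffding_partial_integral)
  show "G V (x(i := t)) = G V x" if "x \<in> space P" "t \<in> space (\<mu> i)" for x t
  proof -
    have "\<forall>j\<in>V. (x(i := t)) j = x j" using V(2) by auto
    then show ?thesis
      using G V(1) that(1) update_in_space[OF that(1) i that(2)]
      unfolding sobol_hoeffding_def by blast
  qed
qed

text \<open>Two distinct index sets differ in some coordinate, so all mixed terms vanish.\<close>

lemma sobol_hoeffding_Parseval:
  assumes F: "sobol_hoeffding d \<mu> f F" and G: "sobol_hoeffding d \<mu> g G"
    and f: "f \<in> L2 P" and g: "g \<in> L2 P"
  shows "(\<integral>x. f x * g x \<partial>P) = (\<Sum>U\<in>Pow {1..d}. \<integral>x. F U x * G U x \<partial>P)"
proof -
  let ?A = "Pow {1..d}"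
  have L2: "F U \<in> L2 P" "G U \<in> L2 P" if "U \<in> ?A" for U
    using that F G by (simp_all add: sobol_hoeffding_L2)
  have "(\<integral>x. f x * g x \<partial>P) = (\<integral>x. (\<Sum>U\<in>?A. \<Sum>V\<in>?A. F U x * G V x) \<partial>P)"
  proof (rule integral_cong_AE)
    show "(\<lambda>x. f x * g x) \<in> borel_measurable P"
      using f g by (intro borel_measurable_integrable L2_mult_integrable)
    show "(\<lambda>x. \<Sum>U\<in>?A. \<Sum>V\<in>?A. F U x * G V x) \<in> borel_measurable P"
      using L2 by (intro borel_measurable_sum borel_measurable_integrable L2_mult_integrable)
    have "AE x in P. f x = (\<Sum>U\<in>?A. F U x)" "AE x in P. g x = (\<Sum>U\<in>?A. G U x)"
      using F G by (simp_all only: sobol_hoeffding_sum)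
    then show "AE x in P. f x * g x = (\<Sum>U\<in>?A. \<Sum>V\<in>?A. F U x * G V x)"
      by eventually_elim (simp add: sum_product)
  qed
  also have "\<dots> = (\<Sum>U\<in>?A. \<integral>x. (\<Sum>V\<in>?A. F U x * G V x) \<partial>P)"
    using L2 by (intro Bochner_Integration.integral_sum Bochner_Integration.integrable_sum L2_mult_integrable)
  also have "\<dots> = (\<Sum>U\<in>?A. \<Sum>V\<in>?A. \<integral>x. F U x * G V x \<partial>P)"
    using L2 by (intro sum.cong refl Bochner_Integration.integral_sum L2_mult_integrable)
  also have "\<dots> = (\<Sum>U\<in>?A. \<integral>x. F U x * G U x \<partial>P)"
  proof (rule sum.cong)
    fix U assume U: "U \<in> ?A"
    have "(\<integral>x. F U x * G V x \<partial>P) = 0" if V: "V \<in> ?A" "V \<noteq> U" for V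
    proof (cases "U \<subseteq> V")
      case False
      then obtain i where "i \<in> U" "i \<notin> V" by blast
      then show ?thesis using sobol_hoeffding_orthogonal[OF F _ _ G, of U i V] U V by simp
    next
      case True
      then obtain i where "i \<in> V" "i \<notin> U" using V by blast
      then show ?thesis
        using sobol_hoeffding_orthogonal[OF G _ _ F, of V i U] U V by (simp add: mult.commute)
    qed
    then have "(\<Sum>V\<in>?A. \<integral>x. F U x * G V x \<partial>P)
        = (\<Sum>V\<in>?A. if V = U then \<integral>x. F U x * G U x \<partial>P else 0)"
      by (intro sum.cong) auto
    also have "\<dots> = (\<integral>x. F U x * G U x \<partial>P)" using U by simp
    finally show "(\<Sum>V\<in>?A. \<integral>x. F U x * G V x \<partial>P) = (\<integral>x. F U x * G U x \<partial>P)" .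
  qed simp
  finally show ?thesis .
qed

lemma variance_sobol_hoeffding:
  assumes F: "sobol_hoeffding d \<mu> f F" and U: "U \<subseteq> {1..d}"
  shows "prob_space.variance P (F U) = (if U = {} then 0 else \<integral>x. (F U x)\<^sup>2 \<partial>P)"
proof (cases "U = {}")
  case True
  interpret prob_space P by (rule prob_space_P)
  have const: "F {} x = expectation f" if "x \<in> space P" for x
    using F that by (rule sobol_hoeffding_empty)
  have "expectation (F {}) = expectation (\<lambda>x. expectation f)"
    using const by (intro Bochner_Integration.integral_cong) auto
  then have mean: "expectation (F {}) = expectation f" by (simp add: prob_space)
  have "variance (F {}) = expectation (\<lambda>x. 0)"
    unfolding mean using const by (intro Bochner_Integration.integral_cong) auto
  then show ?thesis using True by simp
next
  case False
  then obtain i where i: "i \<in> U" by blast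
  have "(\<integral>x. F U x * 1 \<partial>P) = 0"
    using U i sobol_hoeffding_L2[OF F U] sobol_hoeffding_partial_integral[OF F U i]
    by (intro orthogonal_of_partial_integral_zero[of _ _ i] L2_const) auto
  then show ?thesis using False by simp
qed

lemma variance_decomposition:
  assumes F: "sobol_hoeffding d \<mu> f F" and f: "f \<in> L2 P"
  shows "prob_space.variance P f = (\<Sum>U\<in>Pow {1..d}. prob_space.variance P (F U))"
proof -
  interpret prob_space P by (rule prob_space_P)
  let ?A = "Pow {1..d}"
  have "(\<integral>x. (F {} x)\<^sup>2 \<partial>P) = (\<integral>x. (expectation f)\<^sup>2 \<partial>P)"
    by (intro Bochner_Integration.integral_cong) (simp_all add: sobol_hoeffding_empty[OF F])
  then have empty: "(\<integral>x. (F {} x)\<^sup>2 \<partial>P) = (expectation f)\<^sup>2" by (simp add: prob_space)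
  have "(\<Sum>U\<in>?A. variance (F U)) = (\<Sum>U\<in>?A - {{}}. variance (F U))"
    by (intro sum.mono_neutral_right) (auto simp: variance_sobol_hoeffding[OF F])
  also have "\<dots> = (\<Sum>U\<in>?A - {{}}. \<integral>x. (F U x)\<^sup>2 \<partial>P)"
    by (intro sum.cong) (auto simp: variance_sobol_hoeffding[OF F])
  also have "\<dots> = (\<Sum>U\<in>?A. \<integral>x. (F U x)\<^sup>2 \<partial>P) - (expectation f)\<^sup>2"
    by (subst sum.remove[of ?A "{}"]) (auto simp: empty)
  also have "\<dots> = expectation (\<lambda>x. (f x)\<^sup>2) - (expectation f)\<^sup>2"
    using sobol_hoeffding_Parseval[OF F F f f] by (simp add: power2_eq_square)
  also have "\<dots> = variance f"
    using f L2_integrable[OF f] by (intro variance_eq[symmetric]) (auto simp: L2_def)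
  finally show ?thesis ..
qed

text \<open>
  The squared distance of two functions dominates the squared Euclidean distance of the vectors of
  standard deviations of their components.
\<close>

lemma dist_ge_component_dist:
  assumes F: "sobol_hoeffding d \<mu> f F" and G: "sobol_hoeffding d \<mu> g G"
    and f: "f \<in> L2 P" and g: "g \<in> L2 P"
  shows "(\<Sum>U\<in>Pow {1..d}. (sqrt (prob_space.variance P (F U)) - sqrt (prob_space.variance P (G U)))\<^sup>2)
    \<le> (\<integral>x. (f x - g x)\<^sup>2 \<partial>P)"
proof -
  let ?A = "Pow {1..d}"
  note ints = L2_mult_integrable[OF f f] L2_mult_integrable[OF f g] L2_mult_integrable[OF g g]
  have "(\<integral>x. (f x - g x)\<^sup>2 \<partial>P) = (\<integral>x. f x * f x - 2 * (f x * g x) + g x * g x \<partial>P)"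
    by (simp add: power2_eq_square algebra_simps)
  also have "\<dots> = (\<integral>x. f x * f x \<partial>P) - 2 * (\<integral>x. f x * g x \<partial>P) + (\<integral>x. g x * g x \<partial>P)"
    using ints by simp
  also have "\<dots> = (\<Sum>U\<in>?A. (\<integral>x. (F U x)\<^sup>2 \<partial>P) - 2 * (\<integral>x. F U x * G U x \<partial>P) + (\<integral>x. (G U x)\<^sup>2 \<partial>P))"
    unfolding sobol_hoeffding_Parseval[OF F F f f] sobol_hoeffding_Parseval[OF F G f g]
      sobol_hoeffding_Parseval[OF G G g g]
    by (simp add: sum.distrib sum_subtractf sum_distrib_left power2_eq_square)
  finally have dist: "(\<integral>x. (f x - g x)\<^sup>2 \<partial>P)
    = (\<Sum>U\<in>?A. (\<integral>x. (F U x)\<^sup>2 \<partial>P) - 2 * (\<integral>x. F U x * G U x \<partial>P) + (\<integral>x. (G U x)\<^sup>2 \<partial>P))" .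
  show ?thesis
    unfolding dist
  proof (rule sum_mono)
    fix U assume "U \<in> ?A"
    then have U: "U \<subseteq> {1..d}" by simp
    let ?a = "sqrt (\<integral>x. (F U x)\<^sup>2 \<partial>P)" and ?b = "sqrt (\<integral>x. (G U x)\<^sup>2 \<partial>P)"
    have sq: "?a\<^sup>2 = (\<integral>x. (F U x)\<^sup>2 \<partial>P)" "?b\<^sup>2 = (\<integral>x. (G U x)\<^sup>2 \<partial>P)" by simp_all
    have "(\<integral>x. F U x * G U x \<partial>P) \<le> ?a * ?b"
      using sobol_hoeffding_L2[OF F U] sobol_hoeffding_L2[OF G U] by (rule L2_Cauchy_Schwarz)
    then have "(?a - ?b)\<^sup>2
        \<le> (\<integral>x. (F U x)\<^sup>2 \<partial>P) - 2 * (\<integral>x. F U x * G U x \<partial>P) + (\<integral>x. (G U x)\<^sup>2 \<partial>P)"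
      unfolding power2_diff sq by linarith
    moreover have "(sqrt (prob_space.variance P (F U)) - sqrt (prob_space.variance P (G U)))\<^sup>2
        \<le> (?a - ?b)\<^sup>2"
      using U by (simp add: variance_sobol_hoeffding[OF F] variance_sobol_hoeffding[OF G])
    ultimately show "(sqrt (prob_space.variance P (F U)) - sqrt (prob_space.variance P (G U)))\<^sup>2
        \<le> (\<integral>x. (F U x)\<^sup>2 \<partial>P) - 2 * (\<integral>x. F U x * G U x \<partial>P) + (\<integral>x. (G U x)\<^sup>2 \<partial>P)"
      by linarith
  qed
qed

end

section \<open>Comparing shares of two nonnegative vectors\<close>

text \<open>
  With angles, \<open>a = sqrt N * cos \<alpha>\<close>, \<open>a' = sqrt N * sin \<alpha>\<close>, \<open>b = sqrt M * cos \<beta>\<close> and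
  \<open>b' = sqrt M * sin \<beta>\<close>, the difference of the shares is \<open>sin (\<beta> + \<alpha>) * sin (\<beta> - \<alpha>)\<close>, and \<open>D\<close> is
  at least \<open>N * (sin (\<beta> - \<alpha>))\<^sup>2\<close>, the squared distance of \<open>(a, a')\<close> from the line through \<open>(b, b')\<close>.
\<close>

lemma share_difference_plane:
  fixes a a' b b' D N M :: real
  assumes nonneg: "0 \<le> a" "0 \<le> a'" "0 \<le> b" "0 \<le> b'"
    and N: "N = a\<^sup>2 + a'\<^sup>2" "0 < N" and M: "M = b\<^sup>2 + b'\<^sup>2" "0 < M"
    and D: "(a - b)\<^sup>2 + (a' - b')\<^sup>2 \<le> D"
  shows "(a\<^sup>2 / N - b\<^sup>2 / M)\<^sup>2 \<le> D / N"
    and "\<bar>a\<^sup>2 / N - b\<^sup>2 / M\<bar> \<le> sqrt (D / N) * (sqrt (D / N) + 2 * sqrt (a\<^sup>2 / N))"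
proof -
  have D0: "0 \<le> D"
    by (rule order_trans[OF _ D]) simp
  define s where "s = a * b' - b * a'"
  define t where "t = a * b' + b * a'"
  have "a\<^sup>2 * M - b\<^sup>2 * N = s * t"
    by (simp add: s_def t_def N(1) M(1) power2_eq_square algebra_simps)
  then have diff: "a\<^sup>2 / N - b\<^sup>2 / M = s * t / (N * M)"
    using N(2) M(2) by (simp add: diff_frac_eq)
  have "((a - b)\<^sup>2 + (a' - b')\<^sup>2) * M - s\<^sup>2 = ((a - b) * b + (a' - b') * b')\<^sup>2"
    by (simp add: s_def M(1) power2_eq_square algebra_simps)
  then have "s\<^sup>2 \<le> ((a - b)\<^sup>2 + (a' - b')\<^sup>2) * M"
    using zero_le_power2[of "(a - b) * b + (a' - b') * b'"] by linarith
  also have "\<dots> \<le> D * M" using D M(2) by (intro mult_right_mono) auto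
  finally have s: "s\<^sup>2 \<le> D * M" .
  have "N * M - t\<^sup>2 = (a * b - a' * b')\<^sup>2"
    by (simp add: t_def N(1) M(1) power2_eq_square algebra_simps)
  then have t: "t\<^sup>2 \<le> N * M" using zero_le_power2[of "a * b - a' * b'"] by linarith
  have "(a\<^sup>2 / N - b\<^sup>2 / M)\<^sup>2 = s\<^sup>2 * t\<^sup>2 / (N * M)\<^sup>2"
    by (simp add: diff power_divide power_mult_distrib)
  also have "\<dots> \<le> (D * M) * (N * M) / (N * M)\<^sup>2"
    using s t D0 M(2) by (intro divide_right_mono mult_mono) auto
  also have "\<dots> = D / N" using N(2) M(2) by (simp add: power2_eq_square field_simps)
  finally show "(a\<^sup>2 / N - b\<^sup>2 / M)\<^sup>2 \<le> D / N" .
  have s_abs: "\<bar>s\<bar> \<le> sqrt D * sqrt M"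
    using real_sqrt_le_mono[OF s] by (simp add: real_sqrt_mult)
  have "b' \<le> sqrt M" using nonneg by (simp add: M(1) real_le_rsqrt)
  then have "a * b' \<le> a * sqrt M" using nonneg by (intro mult_left_mono)
  then have t_le: "t \<le> 2 * a * sqrt M + sqrt D * sqrt M"
    using s_abs by (simp add: s_def t_def)
  have t0: "0 \<le> t" using nonneg by (simp add: t_def)
  have "\<bar>a\<^sup>2 / N - b\<^sup>2 / M\<bar> = \<bar>s\<bar> * t / (N * M)"
    using t0 N(2) M(2) by (simp add: diff abs_mult)
  also have "\<dots> \<le> (sqrt D * sqrt M) * (2 * a * sqrt M + sqrt D * sqrt M) / (N * M)"
    using s_abs t_le t0 D0 N(2) M(2) by (intro divide_right_mono mult_mono) auto
  also have "\<dots> = sqrt D * (2 * a + sqrt D) * (sqrt M)\<^sup>2 / (N * M)"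
    by (simp add: power2_eq_square algebra_simps)
  also have "\<dots> = sqrt D * (2 * a + sqrt D) / (sqrt N)\<^sup>2"
    using N(2) M(2) by simp
  also have "\<dots> = sqrt (D / N) * (sqrt (D / N) + 2 * sqrt (a\<^sup>2 / N))"
    using nonneg by (simp add: real_sqrt_divide power2_eq_square add_divide_distrib algebra_simps)
  finally show "\<bar>a\<^sup>2 / N - b\<^sup>2 / M\<bar> \<le> sqrt (D / N) * (sqrt (D / N) + 2 * sqrt (a\<^sup>2 / N))" .
qed

text \<open>The same bounds for the share that the indices in \<open>K\<close> take of the total of a nonnegative vector.\<close>

lemma share_difference:
  fixes v w :: "'b \<Rightarrow> real"
  assumes A: "finite A" "K \<subseteq> A"
    and nonneg: "\<And>i. i \<in> A \<Longrightarrow> 0 \<le> v i" "\<And>i. i \<in> A \<Longrightarrow> 0 \<le> w i"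
    and pos: "0 < sum v A" "0 < sum w A"
    and D: "(\<Sum>i\<in>A. (sqrt (v i) - sqrt (w i))\<^sup>2) \<le> D"
  shows "(sum v K / sum v A - sum w K / sum w A)\<^sup>2 \<le> D / sum v A"
    and "\<bar>sum v K / sum v A - sum w K / sum w A\<bar>
      \<le> sqrt (D / sum v A) * (sqrt (D / sum v A) + 2 * sqrt (sum v K / sum v A))"
proof -
  \<comment> \<open>Grouping into \<open>K\<close> and its complement reduces the claim to the plane.\<close>
  let ?n = "\<lambda>u B. L2_set (\<lambda>i. sqrt (u i)) B"
  have sq: "(?n u B)\<^sup>2 = sum u B" if "B \<subseteq> A" "\<And>i. i \<in> A \<Longrightarrow> 0 \<le> u i" for u :: "'b \<Rightarrow> real" and B
  proof -
    have "(\<Sum>i\<in>B. (sqrt (u i))\<^sup>2) = sum u B" using that by (intro sum.cong) auto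
    then show ?thesis using that by (simp add: L2_set_def sum_nonneg subset_iff)
  qed
  have split: "sum u A = sum u K + sum u (A - K)" for u :: "'b \<Rightarrow> real"
    using sum.subset_diff[OF A(2,1), of u] by simp
  have triangle: "(?n v B - ?n w B)\<^sup>2 \<le> (\<Sum>i\<in>B. (sqrt (v i) - sqrt (w i))\<^sup>2)" for B
  proof -
    have "?n v B \<le> ?n w B + L2_set (\<lambda>i. sqrt (v i) - sqrt (w i)) B"
      using L2_set_triangle_ineq[of "\<lambda>i. sqrt (w i)" "\<lambda>i. sqrt (v i) - sqrt (w i)" B] by simp
    moreover have "?n w B \<le> ?n v B + L2_set (\<lambda>i. sqrt (v i) - sqrt (w i)) B"
      using L2_set_triangle_ineq[of "\<lambda>i. sqrt (v i)" "\<lambda>i. sqrt (w i) - sqrt (v i)" B]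
      by (simp add: L2_set_def power2_commute)
    ultimately have "\<bar>?n v B - ?n w B\<bar> \<le> L2_set (\<lambda>i. sqrt (v i) - sqrt (w i)) B" by linarith
    then have "(?n v B - ?n w B)\<^sup>2 \<le> (L2_set (\<lambda>i. sqrt (v i) - sqrt (w i)) B)\<^sup>2"
      using abs_le_square_iff[of "?n v B - ?n w B" "L2_set (\<lambda>i. sqrt (v i) - sqrt (w i)) B"] by simp
    then show ?thesis by (simp add: L2_set_def sum_nonneg)
  qed
  have le: "(?n v K - ?n w K)\<^sup>2 + (?n v (A - K) - ?n w (A - K))\<^sup>2 \<le> D"
    using triangle[of K] triangle[of "A - K"] D unfolding split by linarith
  have vN: "sum v A = (?n v K)\<^sup>2 + (?n v (A - K))\<^sup>2"
    using A nonneg by (subst (1 2) sq) (auto simp: split[of v])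
  have wM: "sum w A = (?n w K)\<^sup>2 + (?n w (A - K))\<^sup>2"
    using A nonneg by (subst (1 2) sq) (auto simp: split[of w])
  have eq: "(?n v K)\<^sup>2 = sum v K" "(?n w K)\<^sup>2 = sum w K"
    using A nonneg by (simp_all add: sq)
  note plane = share_difference_plane[OF L2_set_nonneg L2_set_nonneg L2_set_nonneg L2_set_nonneg
      vN pos(1) wM pos(2) le]
  show "(sum v K / sum v A - sum w K / sum w A)\<^sup>2 \<le> D / sum v A"
    and "\<bar>sum v K / sum v A - sum w K / sum w A\<bar>
      \<le> sqrt (D / sum v A) * (sqrt (D / sum v A) + 2 * sqrt (sum v K / sum v A))"
    using plane unfolding eq by simp_all
qed

section \<open>The error bounds for the indices\<close>

context sobol_space
begin

text \<open>
  Apart from the convention for variance zero, both kinds of index are the share of the variance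
  carried by a family \<open>K\<close> of index sets that is the same for every function.
\<close>

lemma index_eq_share:
  assumes "S \<in> {sobol_index d \<mu>, total_effect_index d \<mu>}" "U \<subseteq> {1..d}"
  obtains K where "K \<subseteq> Pow {1..d}"
    and "\<And>f. prob_space.variance P f \<noteq> 0 \<Longrightarrow>
      S f U = (\<Sum>V\<in>K. prob_space.variance P (sobol_component d \<mu> f V)) / prob_space.variance P f"
    and "\<And>f. prob_space.variance P f = 0 \<Longrightarrow> S f U = 1 / 2 ^ d"
proof (cases "S = sobol_index d \<mu>")
  case True
  then show ?thesis using assms by (intro that[of "{U}"]) (auto simp: sobol_index_def)
next
  case False
  then show ?thesis using assms
    by (intro that[of "{V. V \<subseteq> {1..d} \<and> V \<inter> U \<noteq> {}}"])
      (auto simp: total_effect_index_def sobol_index_def sum_divide_distrib)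
qed

lemma index_nonneg:
  assumes "S \<in> {sobol_index d \<mu>, total_effect_index d \<mu>}" "U \<subseteq> {1..d}"
  shows "0 \<le> S f U"
proof -
  interpret prob_space P by (rule prob_space_P)
  obtain K where "K \<subseteq> Pow {1..d}"
    and pos: "\<And>f. variance f \<noteq> 0 \<Longrightarrow>
        S f U = (\<Sum>V\<in>K. variance (sobol_component d \<mu> f V)) / variance f"
    and zero: "\<And>f. variance f = 0 \<Longrightarrow> S f U = 1 / 2 ^ d"
    using index_eq_share[OF assms] by blast
  show ?thesis
  proof (cases "variance f = 0")
    case True
    then show ?thesis using zero[OF True] by simp
  next
    case False
    show ?thesis
      unfolding pos[OF False] by (intro divide_nonneg_nonneg sum_nonneg variance_positive)
  qed
qed

text \<open>
  The claimed bounds hold for each fixed approximation \<open>g\<close>, with its own relative error \<open>r\<close>.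
\<close>

lemma index_difference:
  assumes f: "f \<in> L2 P" and var: "0 < prob_space.variance P f" and g: "g \<in> L2 P"
    and S: "S \<in> {sobol_index d \<mu>, total_effect_index d \<mu>}" and U: "U \<subseteq> {1..d}"
    and r: "r = L2norm P (\<lambda>x. f x - g x) / sqrt (prob_space.variance P f)"
  shows "(S f U - S g U)\<^sup>2 \<le> r\<^sup>2" "\<bar>S f U - S g U\<bar> \<le> r * (r + 2 * sqrt (S f U))"
    and "\<bar>S f U - S g U\<bar> \<le> 1"
proof -
  interpret prob_space P by (rule prob_space_P)
  define v where "v V = variance (sobol_component d \<mu> f V)" for V
  define w where "w V = variance (sobol_component d \<mu> g V)" for V
  define D where "D = (\<integral>x. (f x - g x)\<^sup>2 \<partial>P)"
  let ?A = "Pow {1..d}"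
  note F = sobol_hoeffding_sobol_component[OF f] and G = sobol_hoeffding_sobol_component[OF g]
  have v: "0 \<le> v V" and w: "0 \<le> w V" for V by (simp_all add: v_def w_def variance_positive)
  have var_f: "variance f = sum v ?A" and var_g: "variance g = sum w ?A"
    unfolding v_def w_def using variance_decomposition[OF F f] variance_decomposition[OF G g]
    by simp_all
  have D: "(\<Sum>V\<in>?A. (sqrt (v V) - sqrt (w V))\<^sup>2) \<le> D"
    unfolding v_def w_def D_def using dist_ge_component_dist[OF F G f g] .
  have D0: "0 \<le> D" by (simp add: D_def)
  have r_eq: "r = sqrt (D / sum v ?A)"
    using r by (simp add: L2norm_def D_def var_f real_sqrt_divide)
  have r2: "r\<^sup>2 = D / sum v ?A" using D0 var by (simp add: r_eq var_f)
  have r0: "0 \<le> r" using D0 var by (simp add: r_eq var_f)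
  obtain K where K: "K \<subseteq> ?A"
    and pos: "\<And>f. variance f \<noteq> 0 \<Longrightarrow>
        S f U = (\<Sum>V\<in>K. variance (sobol_component d \<mu> f V)) / variance f"
    and zero: "\<And>f. variance f = 0 \<Longrightarrow> S f U = 1 / 2 ^ d"
    using index_eq_share[OF S U] by blast
  have Sf: "S f U = sum v K / sum v ?A" using pos[of f] var by (simp add: v_def var_f)
  have range: "0 \<le> sum u K / sum u ?A" "sum u K / sum u ?A \<le> 1"
    if "\<And>V. 0 \<le> u V" for u :: "nat set \<Rightarrow> real"
    using that K sum_mono2[of ?A K u] sum_nonneg[of K u] sum_nonneg[of ?A u]
    by (auto simp: divide_le_eq)
  have Sf_range: "0 \<le> S f U" "S f U \<le> 1" using range[of v, OF v] by (simp_all add: Sf)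
  have "(S f U - S g U)\<^sup>2 \<le> r\<^sup>2 \<and> \<bar>S f U - S g U\<bar> \<le> r * (r + 2 * sqrt (S f U)) \<and> \<bar>S f U - S g U\<bar> \<le> 1"
  proof (cases "variance g = 0")
    case False
    then have Sg: "S g U = sum w K / sum w ?A" using pos[of g] by (simp add: w_def var_g)
    have "0 < sum w ?A" using False sum_nonneg[of ?A w] w by (simp add: var_g less_le)
    note * = share_difference[OF _ K v w _ this D]
    have "(S f U - S g U)\<^sup>2 \<le> r\<^sup>2"
      unfolding Sf Sg r2 using var by (intro *) (auto simp: var_f)
    moreover have "\<bar>S f U - S g U\<bar> \<le> r * (r + 2 * sqrt (S f U))"
      unfolding Sf Sg r_eq using var by (intro *) (auto simp: var_f)
    moreover have "\<bar>S f U - S g U\<bar> \<le> 1"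
      using Sf_range range[of w, OF w] unfolding Sg by linarith
    ultimately show ?thesis by blast
  next
    \<comment> \<open>A constant approximation has relative error at least one, which exceeds any
      difference of numbers in the unit interval.\<close>
    case True
    have "w V = 0" if "V \<in> ?A" for V
      using True that w sum_nonneg_eq_0_iff[of ?A w] by (auto simp: var_g)
    then have "(\<Sum>V\<in>?A. (sqrt (v V) - sqrt (w V))\<^sup>2) = sum v ?A"
      using v by (intro sum.cong) auto
    then have "1 \<le> r\<^sup>2" using D var by (simp add: r2 var_f)
    moreover have "S g U = 1 / 2 ^ d" using zero True by blast
    then have "0 \<le> S g U" "S g U \<le> 1" by simp_all
    then have le1: "\<bar>S f U - S g U\<bar> \<le> 1" using Sf_range by linarith
    moreover have "(S f U - S g U)\<^sup>2 \<le> 1" using le1 by (simp add: abs_square_le_1)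
    moreover have "r\<^sup>2 \<le> r * (r + 2 * sqrt (S f U))"
      using r0 Sf_range by (simp add: power2_eq_square mult_left_mono)
    ultimately show ?thesis by linarith
  qed
  then show "(S f U - S g U)\<^sup>2 \<le> r\<^sup>2" "\<bar>S f U - S g U\<bar> \<le> r * (r + 2 * sqrt (S f U))"
    and "\<bar>S f U - S g U\<bar> \<le> 1" by blast+
qed

end

theorem theorem4:
  fixes d n :: nat
    and X :: "nat \<Rightarrow> real set"
    and \<mu> :: "nat \<Rightarrow> real measure"
    and P :: "(nat \<Rightarrow> real) measure"
    and f :: "(nat \<Rightarrow> real) \<Rightarrow> real"
    and M :: "'w measure"
    and x :: "nat \<Rightarrow> 'w \<Rightarrow> (nat \<Rightarrow> real)"
    and \<eta> :: "nat \<Rightarrow> 'w \<Rightarrow> real"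
    and \<sigma> :: real
    and learn :: "(nat \<Rightarrow> nat \<Rightarrow> real) \<Rightarrow> (nat \<Rightarrow> real) \<Rightarrow> ((nat \<Rightarrow> real) \<Rightarrow> real)"
    and fhat :: "'w \<Rightarrow> (nat \<Rightarrow> real) \<Rightarrow> real"
    and R :: real
  assumes mu_prob: "\<And>i. i \<in> {1..d} \<Longrightarrow> prob_space (\<mu> i)"
    and mu_sets: "\<And>i. i \<in> {1..d} \<Longrightarrow> sets (\<mu> i) = sets (restrict_space borel (X i))"
    and P_def: "P = PiM {1..d} \<mu>"
    and f_L2: "f \<in> L2 P"
    and f_var: "prob_space.variance P f > 0"
    and M_prob: "prob_space M"
    and design_indep: "prob_space.indep_vars M (\<lambda>_. P) x {1..n}"
    and design_distr: "\<And>j. j \<in> {1..n} \<Longrightarrow> distr M P (x j) = P"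
    and noise_indep: "prob_space.indep_vars M (\<lambda>_. borel) \<eta> {1..n}"
    and noise_ident: "\<And>j k. j \<in> {1..n} \<Longrightarrow> k \<in> {1..n} \<Longrightarrow> distr M borel (\<eta> j) = distr M borel (\<eta> k)"
    and noise_square_integrable: "\<And>j. j \<in> {1..n} \<Longrightarrow> integrable M (\<lambda>\<omega>. (\<eta> j \<omega>)\<^sup>2)"
    and noise_mean: "\<And>j. j \<in> {1..n} \<Longrightarrow> prob_space.expectation M (\<eta> j) = 0"
    and noise_variance: "\<And>j. j \<in> {1..n} \<Longrightarrow> prob_space.variance M (\<eta> j) = \<sigma>\<^sup>2"
    and design_noise_indep:
      "prob_space.indep_set M
         (sets (vimage_algebra (space M) (\<lambda>\<omega>. \<lambda>j\<in>{1..n}. x j \<omega>) (PiM {1..n} (\<lambda>_. P))))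
         (sets (vimage_algebra (space M) (\<lambda>\<omega>. \<lambda>j\<in>{1..n}. \<eta> j \<omega>) (PiM {1..n} (\<lambda>_. borel))))"
    and learn_L2:
      "\<And>xs ys. xs \<in> {1..n} \<rightarrow>\<^sub>E space P \<Longrightarrow> ys \<in> {1..n} \<rightarrow>\<^sub>E UNIV \<Longrightarrow> learn xs ys \<in> L2 P"
    and fhat_def:
      "\<And>\<omega>. fhat \<omega> = learn (\<lambda>j\<in>{1..n}. x j \<omega>) (\<lambda>j\<in>{1..n}. f (x j \<omega>) + \<eta> j \<omega>)"
    and error_integrable: "integrable M (\<lambda>\<omega>. (L2norm P (\<lambda>z. f z - fhat \<omega> z))\<^sup>2)"
    and index_error_measurable:
      "\<And>S U. S \<in> {sobol_index d \<mu>, total_effect_index d \<mu>} \<Longrightarrow> U \<subseteq> {1..d} \<Longrightarrow>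
         (\<lambda>\<omega>. \<bar>S f U - S (fhat \<omega>) U\<bar>) \<in> borel_measurable M"
    and R_nonneg: "0 \<le> R"
    and R_def:
      "R\<^sup>2 = prob_space.expectation M (\<lambda>\<omega>. (L2norm P (\<lambda>z. f z - fhat \<omega> z))\<^sup>2)
              / prob_space.variance P f"
  shows "\<forall>S\<in>{sobol_index d \<mu>, total_effect_index d \<mu>}.
    Max ((\<lambda>U. prob_space.expectation M (\<lambda>\<omega>. (S f U - S (fhat \<omega>) U)\<^sup>2)) ` Pow {1..d}) \<le> R\<^sup>2 \<and>
    (\<forall>U\<subseteq>{1..d}.
       prob_space.expectation M (\<lambda>\<omega>. \<bar>S f U - S (fhat \<omega>) U\<bar>) \<le> R * (R + 2 * sqrt (S f U)))"
proof (intro ballI conjI allI impI)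
  fix S assume S: "S \<in> {sobol_index d \<mu>, total_effect_index d \<mu>}"
  interpret sobol_space d \<mu>
    by (intro sobol_space.intro finite_prob_family.intro finite_atLeastAtMost mu_prob)
  interpret M: prob_space M by (rule M_prob)
  \<comment> \<open>The relative error for a fixed sample, whose mean square is \<open>R\<^sup>2\<close>.\<close>
  define r where "r \<omega> = L2norm P (\<lambda>z. f z - fhat \<omega> z) / sqrt (prob_space.variance P f)" for \<omega>
  have fhat_L2: "fhat \<omega> \<in> L2 P" if \<omega>: "\<omega> \<in> space M" for \<omega>
  proof -
    have "x j \<omega> \<in> space P" if "j \<in> {1..n}" for j
      using design_indep that \<omega> unfolding M.indep_vars_def by (blast dest: measurable_space)
    then show ?thesis unfolding fhat_def by (intro learn_L2) auto
  qed
  have bounds: "(S f U - S (fhat \<omega>) U)\<^sup>2 \<le> (r \<omega>)\<^sup>2"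
    "\<bar>S f U - S (fhat \<omega>) U\<bar> \<le> r \<omega> * (r \<omega> + 2 * sqrt (S f U))"
    "\<bar>S f U - S (fhat \<omega>) U\<bar> \<le> 1"
    if "\<omega> \<in> space M" "U \<subseteq> {1..d}" for \<omega> U
    using index_difference[OF f_L2[unfolded P_def] f_var[unfolded P_def]
        fhat_L2[OF that(1), unfolded P_def] S that(2) r_def[unfolded P_def]]
    by blast+
  have r2: "(r \<omega>)\<^sup>2 = (L2norm P (\<lambda>z. f z - fhat \<omega> z))\<^sup>2 / prob_space.variance P f" for \<omega>
    using f_var by (simp add: r_def power_divide)
  have r0: "0 \<le> r \<omega>" for \<omega>
    using f_var by (simp add: r_def L2norm_def)
  have r2_int: "integrable M (\<lambda>\<omega>. (r \<omega>)\<^sup>2)"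
    unfolding r2 using error_integrable by simp
  have Er2: "M.expectation (\<lambda>\<omega>. (r \<omega>)\<^sup>2) = R\<^sup>2"
    unfolding r2 R_def by simp
  have [measurable]: "(\<lambda>\<omega>. (r \<omega>)\<^sup>2) \<in> borel_measurable M"
    using r2_int by (rule borel_measurable_integrable)
  have "(\<lambda>\<omega>. sqrt ((r \<omega>)\<^sup>2)) \<in> borel_measurable M"
    by measurable
  then have "r \<in> borel_measurable M"
    using r0 by simp
  then have r_int: "integrable M r"
    using r2_int by (rule M.square_integrable_imp_integrable)
  \<comment> \<open>Nonnegativity of the variance of \<open>r\<close> bounds its mean by its root mean square.\<close>
  have "(M.expectation r)\<^sup>2 \<le> R\<^sup>2"
    using M.variance_eq[OF r_int r2_int] M.variance_positive[of r] Er2 by linarith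
  then have Er: "M.expectation r \<le> R"
    using R_nonneg by (rule power2_le_imp_le)
  have meas: "(\<lambda>\<omega>. \<bar>S f U - S (fhat \<omega>) U\<bar>) \<in> borel_measurable M" if "U \<subseteq> {1..d}" for U
    using index_error_measurable[OF S that] .
  have "M.expectation (\<lambda>\<omega>. (S f U - S (fhat \<omega>) U)\<^sup>2) \<le> R\<^sup>2" if U: "U \<subseteq> {1..d}" for U
  proof -
    have "integrable M (\<lambda>\<omega>. \<bar>S f U - S (fhat \<omega>) U\<bar>\<^sup>2)"
      using r2_int
    proof (rule Bochner_Integration.integrable_bound)
      show "(\<lambda>\<omega>. \<bar>S f U - S (fhat \<omega>) U\<bar>\<^sup>2) \<in> borel_measurable M"
        using meas[OF U] by (rule borel_measurable_power)
      show "AE \<omega> in M. norm (\<bar>S f U - S (fhat \<omega>) U\<bar>\<^sup>2) \<le> norm ((r \<omega>)\<^sup>2)"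
        using bounds(1)[OF _ U] by (intro AE_I2) simp
    qed
    then have "M.expectation (\<lambda>\<omega>. (S f U - S (fhat \<omega>) U)\<^sup>2) \<le> M.expectation (\<lambda>\<omega>. (r \<omega>)\<^sup>2)"
      using r2_int bounds(1)[OF _ U] by (intro integral_mono) simp_all
    then show ?thesis unfolding Er2 .
  qed
  then show "Max ((\<lambda>U. M.expectation (\<lambda>\<omega>. (S f U - S (fhat \<omega>) U)\<^sup>2)) ` Pow {1..d}) \<le> R\<^sup>2"
    by (subst Max_le_iff) auto
  fix U assume U: "U \<subseteq> {1..d}"
  let ?c = "2 * sqrt (S f U)"
  have c: "0 \<le> ?c" using index_nonneg[OF S U] by simp
  have "integrable M (\<lambda>\<omega>. \<bar>S f U - S (fhat \<omega>) U\<bar>)"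
    using bounds(3)[OF _ U] by (intro M.integrable_const_bound[of _ 1] meas[OF U] AE_I2) simp
  then have "M.expectation (\<lambda>\<omega>. \<bar>S f U - S (fhat \<omega>) U\<bar>) \<le> M.expectation (\<lambda>\<omega>. (r \<omega>)\<^sup>2 + ?c * r \<omega>)"
    using r_int r2_int bounds(2)[OF _ U]
    by (intro integral_mono) (simp_all add: power2_eq_square algebra_simps)
  also have "\<dots> = R\<^sup>2 + ?c * M.expectation r"
    using r_int r2_int Er2 by simp
  also have "\<dots> \<le> R\<^sup>2 + ?c * R"
    using Er c by (intro add_left_mono mult_left_mono)
  also have "\<dots> = R * (R + ?c)" by (simp add: power2_eq_square algebra_simps)
  finally show "M.expectation (\<lambda>\<omega>. \<bar>S f U - S (fhat \<omega>) U\<bar>) \<le> R * (R + 2 * sqrt (S f U))" .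
qed

end
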